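(* For every integer $d\geq 4$, the surface $$D''_d:\quad f=x^{d-1}z+y^d+x^{d-2}yw=0$$ in $\mathbb{P}^3$ is nearly free with exponents $(1,1,d-2)$.
   Context: $S=\mathbb{C}[x,y,z,w]$ is the standard graded coordinate ring of $\mathbb{P}^3$. For $f\in S$ homogeneous of degree $d$, $J_f$ is the ideal generated by the partial derivatives of $f$ and $M(f)=S/J_f$ is the Milnor algebra. A surface is a cone if, after a linear change of coordinates, $f$ does not depend on one of the variables. A reduced surface $D:f=0$ of degree $d$ that is not a cone is called nearly free with exponents $1\le d_1\le d_2\le d_3$ if the minimal graded free resolution of $M(f)$ has the form $$0\to S(-d_3-d)\to S(-d_1-(d-1))\oplus S(-d_2-(d-1))\oplus S(-d_3-(d-1))^2\to S(-(d-1))^4\to S.$$ *)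

theory Defs
  imports
    "HOL-Library.Poly_Mapping"
    "HOL-Library.Numeral_Type"
    "HOL-Analysis.Cartesian_Space"
    "HOL-Computational_Algebra.Squarefree"
    "Jordan_Normal_Form.Matrix_Kernel"
begin

section \<open>The polynomial ring in four variables\<close>

text \<open>
  The ring \<open>S = \<complex>[x,y,z,w]\<close> is the monoid algebra of the exponent vectors \<open>4 \<Rightarrow>\<^sub>0 nat\<close>; the variables
  \<open>x, y, z, w\<close> are those with index \<open>0, 1, 2, 3\<close> of the four-element type.
\<close>

type_synonym quadpoly = "(4 \<Rightarrow>\<^sub>0 nat) \<Rightarrow>\<^sub>0 complex"

definition Var :: "4 \<Rightarrow> quadpoly" where
  "Var i = Poly_Mapping.single (Poly_Mapping.single i 1) 1"

definition Const :: "complex \<Rightarrow> quadpoly" where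
  "Const c = Poly_Mapping.single 0 c"

definition monom_degree :: "(4 \<Rightarrow>\<^sub>0 nat) \<Rightarrow> nat" where
  "monom_degree m = (\<Sum>i\<in>UNIV. Poly_Mapping.lookup m i)"

text \<open>
  \<open>homogeneous k p\<close> says that \<open>p\<close> lies in the graded piece \<open>S\<^sub>k\<close>. It holds of \<open>0\<close> for every \<open>k\<close>, and
  \<open>S\<^sub>k = 0\<close> for \<open>k < 0\<close>.
\<close>

definition homogeneous :: "int \<Rightarrow> quadpoly \<Rightarrow> bool" where
  "homogeneous k p \<longleftrightarrow> (\<forall>m\<in>Poly_Mapping.keys p. int (monom_degree m) = k)"

text \<open>
  In the next definition the exponent subtraction truncates only where the coefficient is \<open>0\<close>.
\<close>

definition partial_deriv :: "4 \<Rightarrow> quadpoly \<Rightarrow> quadpoly" where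
  "partial_deriv i p = (\<Sum>m\<in>Poly_Mapping.keys p.
     Poly_Mapping.single (m - Poly_Mapping.single i 1)
       (of_nat (Poly_Mapping.lookup m i) * Poly_Mapping.lookup p m))"

definition ideal_generated :: "quadpoly set \<Rightarrow> quadpoly set" where
  "ideal_generated B = Modules.module.span (*) B"

text \<open>\<open>S\<close> is a module over itself, so the facts about \<^const>\<open>Modules.module.span\<close> apply.\<close>

lemma module_mult: "Modules.module ((*) :: quadpoly \<Rightarrow> quadpoly \<Rightarrow> quadpoly)"
  by unfold_locales (auto simp: algebra_simps)

definition irrelevant_ideal :: "quadpoly set" where
  "irrelevant_ideal = ideal_generated (Set.range Var)"

definition jacobian_ideal :: "quadpoly \<Rightarrow> quadpoly set" where
  "jacobian_ideal f = ideal_generated (Set.range (\<lambda>i. partial_deriv i f))"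

definition residue_class :: "quadpoly set \<Rightarrow> quadpoly \<Rightarrow> quadpoly set" where
  "residue_class I p = {q. q - p \<in> I}"

section \<open>Cones\<close>

definition linear_change :: "complex^4^4 \<Rightarrow> quadpoly \<Rightarrow> quadpoly" where
  "linear_change A p = (\<Sum>m\<in>Poly_Mapping.keys p. Const (Poly_Mapping.lookup p m) *
     (\<Prod>i\<in>UNIV. (\<Sum>j\<in>UNIV. Const (vec_nth (vec_nth A i) j) * Var j) ^ Poly_Mapping.lookup m i))"

definition depends_on :: "quadpoly \<Rightarrow> 4 \<Rightarrow> bool" where
  "depends_on p i \<longleftrightarrow> (\<exists>m\<in>Poly_Mapping.keys p. Poly_Mapping.lookup m i \<noteq> 0)"

definition cone :: "quadpoly \<Rightarrow> bool" where
  "cone f \<longleftrightarrow> (\<exists>A. invertible A \<and> (\<exists>i. \<not> depends_on (linear_change A f) i))"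

section \<open>Graded free resolutions of cyclic modules\<close>

text \<open>
  The list \<open>[e\<^sub>1, \<dots>, e\<^sub>n]\<close> stands for the graded free module \<open>S(e\<^sub>1) \<oplus> \<dots> \<oplus> S(e\<^sub>n)\<close>, whose underlying
  module is the set of column vectors of length \<open>n\<close>; here \<open>S(e)\<^sub>k = S\<^bsub>e+k\<^esub>\<close>, so that the \<open>j\<close>-th basis
  vector has degree \<open>-e\<^sub>j\<close>. Homomorphisms of degree \<open>0\<close> are given by matrices acting on columns; as
  multiplication by \<open>p\<close> is a map \<open>S(e) \<rightarrow> S(e')\<close> of degree \<open>0\<close> iff \<open>p \<in> S\<^bsub>e'-e\<^esub>\<close>, the entries are
  homogeneous of the degrees below.
\<close>

definition graded_hom :: "int list \<Rightarrow> int list \<Rightarrow> quadpoly mat \<Rightarrow> bool" where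
  "graded_hom E E' A \<longleftrightarrow> A \<in> carrier_mat (length E') (length E) \<and>
     (\<forall>i<length E'. \<forall>j<length E. homogeneous (E' ! i - E ! j) (A $$ (i, j)))"

definition mat_image :: "quadpoly mat \<Rightarrow> quadpoly vec set" where
  "mat_image A = (\<lambda>v. A *\<^sub>v v) ` carrier_vec (dim_col A)"

text \<open>
  The homomorphism \<open>S(e\<^sub>1) \<oplus> \<dots> \<oplus> S(e\<^sub>n) \<rightarrow> S/I\<close> that sends the \<open>j\<close>-th basis vector to the class of the
  \<open>j\<close>-th entry of \<open>a\<close>. Every homomorphism to \<open>S/I\<close> is of this form, and for a homogeneous ideal \<open>I\<close> it
  has degree \<open>0\<close> iff the entries can be chosen with \<open>a\<^sub>j \<in> S\<^bsub>-e\<^sub>j\<^esub>\<close>.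
\<close>

definition augmentation :: "quadpoly set \<Rightarrow> quadpoly vec \<Rightarrow> quadpoly vec \<Rightarrow> quadpoly set" where
  "augmentation I a v = residue_class I (scalar_prod a v)"

text \<open>
  \<open>\<dots> \<rightarrow> F\<^sub>2 \<rightarrow> F\<^sub>1 \<rightarrow> F\<^sub>0 \<rightarrow> S/I \<rightarrow> 0\<close> is exact, with \<open>\<phi> n : F\<^bsub>n+1\<^esub> \<rightarrow> F\<^sub>n\<close>.
\<close>

definition graded_free_resolution ::
  "quadpoly set \<Rightarrow> (nat \<Rightarrow> int list) \<Rightarrow> (nat \<Rightarrow> quadpoly mat) \<Rightarrow> quadpoly vec \<Rightarrow> bool" where
  "graded_free_resolution I F \<phi> a \<longleftrightarrow>
     (\<forall>n. graded_hom (F (Suc n)) (F n) (\<phi> n)) \<and>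
     a \<in> carrier_vec (length (F 0)) \<and>
     (\<forall>j<length (F 0). homogeneous (- (F 0 ! j)) (vec_index a j)) \<and>
     augmentation I a ` carrier_vec (length (F 0)) = Set.range (residue_class I) \<and>
     {v \<in> carrier_vec (length (F 0)). augmentation I a v = residue_class I 0} = mat_image (\<phi> 0) \<and>
     (\<forall>n. mat_kernel (\<phi> n) = mat_image (\<phi> (Suc n)))"

text \<open>Minimality: \<open>\<phi> n\<close> maps \<open>F\<^bsub>n+1\<^esub>\<close> into \<open>(x,y,z,w) F\<^sub>n\<close>.\<close>

definition minimal_graded_free_resolution ::
  "quadpoly set \<Rightarrow> (nat \<Rightarrow> int list) \<Rightarrow> (nat \<Rightarrow> quadpoly mat) \<Rightarrow> quadpoly vec \<Rightarrow> bool" where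
  "minimal_graded_free_resolution I F \<phi> a \<longleftrightarrow>
     graded_free_resolution I F \<phi> a \<and>
     (\<forall>n. \<forall>i<length (F n). \<forall>j<length (F (Suc n)). \<phi> n $$ (i, j) \<in> irrelevant_ideal)"

text \<open>
  The minimal graded free resolution of \<open>S/I\<close> has the form \<open>0 \<rightarrow> F\<^sub>l \<rightarrow> \<dots> \<rightarrow> F\<^sub>0\<close> for the given list of
  the modules \<open>F\<^sub>0, \<dots>, F\<^sub>l\<close>. As it is unique up to isomorphism, this means that one of this form exists.
\<close>

definition minimal_resolution_has_form :: "quadpoly set \<Rightarrow> int list list \<Rightarrow> bool" where
  "minimal_resolution_has_form I Fs \<longleftrightarrow>
     (\<exists>\<phi> a. minimal_graded_free_resolution I (\<lambda>n. if n < length Fs then Fs ! n else []) \<phi> a)"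

section \<open>Nearly free surfaces\<close>

text \<open>
  \<open>nearly_free d f (d\<^sub>1, d\<^sub>2, d\<^sub>3)\<close>: the surface \<open>f = 0\<close> of degree \<open>d\<close> is nearly free with exponents
  \<open>d\<^sub>1 \<le> d\<^sub>2 \<le> d\<^sub>3\<close>. The surface is reduced iff \<open>f\<close> has no multiple factor.
\<close>

definition nearly_free :: "nat \<Rightarrow> quadpoly \<Rightarrow> nat \<times> nat \<times> nat \<Rightarrow> bool" where
  "nearly_free d f = (\<lambda>(d\<^sub>1, d\<^sub>2, d\<^sub>3).
     f \<noteq> 0 \<and> homogeneous (int d) f \<and> squarefree f \<and> \<not> cone f \<and>
     1 \<le> d\<^sub>1 \<and> d\<^sub>1 \<le> d\<^sub>2 \<and> d\<^sub>2 \<le> d\<^sub>3 \<and>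
     minimal_resolution_has_form (jacobian_ideal f)
       [[0],
        replicate 4 (- (int d - 1)),
        [- int d\<^sub>1 - (int d - 1), - int d\<^sub>2 - (int d - 1), - int d\<^sub>3 - (int d - 1), - int d\<^sub>3 - (int d - 1)],
        [- int d\<^sub>3 - int d]])"

end

theory Submission
  imports Defs
begin

text \<open>
  Put \<open>d = n + 4\<close>, so that \<open>f = x\<^bsup>n+3\<^esup>z + y\<^bsup>n+4\<^esup> + x\<^bsup>n+2\<^esup>yw\<close>. The derivatives
  \<open>f\<^sub>z = x\<^bsup>n+3\<^esup>\<close> and \<open>f\<^sub>w = x\<^bsup>n+2\<^esup>y\<close> are monomials, and
  \<open>f\<^sub>x = x\<^bsup>n+1\<^esup> ((d-1) x z + (d-2) y w)\<close>, \<open>f\<^sub>y = d y\<^bsup>n+3\<^esup> + x\<^bsup>n+2\<^esup>w\<close>. The syzygies and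
  reducedness are settled by divisibility by the variables.

  Syzygies. Two linear ones are visible: \<open>y f\<^sub>z - x f\<^sub>w = 0\<close> and
  \<open>x f\<^sub>x - (d-1) z f\<^sub>z - (d-2) w f\<^sub>w = 0\<close>. Now let \<open>a f\<^sub>x + b f\<^sub>y + c f\<^sub>z + e f\<^sub>w = 0\<close>. All derivatives but
  \<open>f\<^sub>y\<close> are divisible by \<open>x\<^bsup>n+1\<^esup>\<close>, and \<open>f\<^sub>y\<close> is \<open>d y\<^bsup>n+3\<^esup>\<close> modulo that power, so \<open>b = x\<^bsup>n+1\<^esup>b'\<close>.
  After cancelling \<open>x\<^bsup>n+1\<^esup>\<close> and reducing modulo \<open>x\<close>, what is left is
  \<open>(d-2) w a + d y\<^bsup>n+2\<^esup>b' \<equiv> 0\<close>, whence \<open>b' \<in> (x, w)\<close>. So \<open>b\<close> lies in the ideal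
  \<open>(x\<^bsup>n+2\<^esup>, x\<^bsup>n+1\<^esup>w)\<close>, and each generator is the \<open>f\<^sub>y\<close>-coefficient of a syzygy of degree
  \<open>n + 2 = d - 2\<close>. Subtracting multiples of these two kills \<open>b\<close> and makes \<open>a\<close> divisible by \<open>x\<close>; the two
  linear syzygies account for the rest (\<open>syzygies_of_gradient\<close>). The two syzygies of degree \<open>d - 2\<close>
  are related because \<open>w x\<^bsup>n+2\<^esup> = x (x\<^bsup>n+1\<^esup>w)\<close>, and this is the only second syzygy
  (\<open>mat_kernel_syzygy\<close>). The resulting complex is minimal because every entry of its matrices is
  homogeneous of positive degree.

  Reducedness. If \<open>p\<^sup>2\<close> divides \<open>f\<close> then \<open>p\<close> divides all derivatives, hence \<open>f\<^sub>z = x\<^bsup>n+3\<^esup>\<close> and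
  \<open>y f\<^sub>y - w f\<^sub>w = d y\<^bsup>n+4\<^esup>\<close>, which are coprime.

  No cone. If \<open>f\<close> were a cone, the function \<open>f\<close> on \<open>\<complex>\<^sup>4\<close> would be invariant under translation along
  some line through \<open>0\<close>; a few values of \<open>f\<close> exclude this.
\<close>

section \<open>Evaluation homomorphisms\<close>

lemma comm_ring_hom_Const: "comm_ring_hom Const"
  by unfold_locales (simp_all add: Const_def single_add mult_single)

lemma Const_inverse_of_nat: "k \<noteq> 0 \<Longrightarrow> Const (1 / of_nat k) * of_nat k = 1"
  by (simp add: Const_def mult_single flip: single_of_nat)

text \<open>
  Additive and multiplicative identities for polynomials are checked on monomials with this rule, in
  both arguments if necessary.
\<close>
lemma poly_additive_induct [case_names add single]:
  fixes p :: quadpoly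
  assumes add: "\<And>p q. P p \<Longrightarrow> P q \<Longrightarrow> P (p + q)"
    and single: "\<And>m c. P (Poly_Mapping.single m c)"
  shows "P p"
proof (induction p rule: update_induct)
  case const
  show ?case using single[of 0 0] by simp
next
  case (update p m c)
  have "Poly_Mapping.update m c p = p + Poly_Mapping.single m c"
    using update(1)
    by (intro poly_mapping_eqI) (auto simp: lookup_update lookup_add lookup_single when_def in_keys_iff)
  with add[OF update(3) single] show ?case by simp
qed

lemma single_monomial:
  "Poly_Mapping.single m c = Const c * (\<Prod>i\<in>UNIV. Var i ^ Poly_Mapping.lookup m i)"
proof -
  have pow: "Var i ^ k = Poly_Mapping.single (Poly_Mapping.single i k) 1" for i k
    by (induction k) (simp_all add: Var_def mult_single flip: single_add)
  have "(\<Prod>i\<in>I. Var i ^ Poly_Mapping.lookup m i)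
      = Poly_Mapping.single (\<Sum>i\<in>I. Poly_Mapping.single i (Poly_Mapping.lookup m i)) 1" if "finite I" for I
    using that by induction (simp_all add: pow mult_single)
  moreover have "(\<Sum>i\<in>UNIV. Poly_Mapping.single i (Poly_Mapping.lookup m i)) = m"
    by (rule poly_mapping_eqI) (simp add: lookup_sum lookup_single when_def)
  ultimately show ?thesis
    by (simp add: Const_def mult_single)
qed

lemma quadpoly_induct [case_names Const Var add mult]:
  assumes Const: "\<And>c. P (Const c)" and Var: "\<And>i. P (Var i)"
    and add: "\<And>p q. P p \<Longrightarrow> P q \<Longrightarrow> P (p + q)" and mult: "\<And>p q. P p \<Longrightarrow> P q \<Longrightarrow> P (p * q)"
  shows "P p"
proof (induction p rule: poly_additive_induct)
  case (single m c)
  have one: "P 1" using Const[of 1] by (simp add: Const_def)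
  have "P (Var i ^ k)" for i k
    by (induction k) (auto intro: one mult Var)
  then have pow: "P (Var i ^ Poly_Mapping.lookup m i)" for i .
  have "P (\<Prod>i\<in>I. Var i ^ Poly_Mapping.lookup m i)" if "finite I" for I
    using that by induction (auto intro: one mult pow)
  then show ?case unfolding single_monomial by (auto intro: mult Const)
qed (rule add)

text \<open>
  The coefficients are carried along a map \<open>\<iota>\<close> so that one notion covers both the values of a
  polynomial at points of \<open>\<complex>\<^sup>4\<close> (\<open>\<iota> = id\<close>) and substitutions into polynomials (\<open>\<iota> = Const\<close>).
\<close>
definition poly_eval :: "(complex \<Rightarrow> 'a::comm_ring_1) \<Rightarrow> (4 \<Rightarrow> 'a) \<Rightarrow> quadpoly \<Rightarrow> 'a" where
  "poly_eval \<iota> \<sigma> p =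
     (\<Sum>m\<in>Poly_Mapping.keys p. \<iota> (Poly_Mapping.lookup p m) * (\<Prod>i\<in>UNIV. \<sigma> i ^ Poly_Mapping.lookup m i))"

context
  fixes \<iota> :: "complex \<Rightarrow> 'a::comm_ring_1" and \<sigma> :: "4 \<Rightarrow> 'a"
  assumes \<iota>: "comm_ring_hom \<iota>"
begin

interpretation comm_ring_hom \<iota> by (rule \<iota>)

lemma poly_eval_superset:
  assumes "finite K" "Poly_Mapping.keys p \<subseteq> K"
  shows "poly_eval \<iota> \<sigma> p =
     (\<Sum>m\<in>K. \<iota> (Poly_Mapping.lookup p m) * (\<Prod>i\<in>UNIV. \<sigma> i ^ Poly_Mapping.lookup m i))"
  unfolding poly_eval_def by (rule sum.mono_neutral_left) (use assms in \<open>auto simp: in_keys_iff\<close>)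

lemma poly_eval_single:
  "poly_eval \<iota> \<sigma> (Poly_Mapping.single m c) = \<iota> c * (\<Prod>i\<in>UNIV. \<sigma> i ^ Poly_Mapping.lookup m i)"
  by (subst poly_eval_superset[of "{m}"]) auto

lemma poly_eval_Const: "poly_eval \<iota> \<sigma> (Const c) = \<iota> c"
  by (simp add: Const_def poly_eval_single)

lemma poly_eval_Var: "poly_eval \<iota> \<sigma> (Var i) = \<sigma> i"
proof -
  have "(\<Prod>j\<in>UNIV. \<sigma> j ^ Poly_Mapping.lookup (Poly_Mapping.single i 1) j)
      = (\<Prod>j\<in>UNIV. if j = i then \<sigma> j else 1)"
    by (rule prod.cong) (auto simp: lookup_single)
  then show ?thesis
    by (simp add: Var_def poly_eval_single)
qed

lemma poly_eval_add: "poly_eval \<iota> \<sigma> (p + q) = poly_eval \<iota> \<sigma> p + poly_eval \<iota> \<sigma> q"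
proof -
  let ?K = "Poly_Mapping.keys p \<union> Poly_Mapping.keys q"
  have "Poly_Mapping.keys (p + q) \<subseteq> ?K" by (rule Poly_Mapping.keys_add)
  then show ?thesis
    by (subst (1 2 3) poly_eval_superset[of ?K])
      (auto simp: lookup_add hom_add distrib_right sum.distrib)
qed

lemma poly_eval_mult: "poly_eval \<iota> \<sigma> (p * q) = poly_eval \<iota> \<sigma> p * poly_eval \<iota> \<sigma> q"
proof (induction p rule: poly_additive_induct)
  case (single m c)
  show ?case
    by (induction q rule: poly_additive_induct)
      (simp_all add: distrib_left poly_eval_add mult_single poly_eval_single hom_mult lookup_add
        power_add prod.distrib mult.assoc mult.left_commute)
qed (simp add: distrib_right poly_eval_add)

lemma comm_ring_hom_poly_eval: "comm_ring_hom (poly_eval \<iota> \<sigma>)"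
proof
  show "poly_eval \<iota> \<sigma> 1 = 1" using poly_eval_Const[of 1] by (simp add: Const_def)
  show "poly_eval \<iota> \<sigma> 0 = 0" by (simp add: poly_eval_def)
qed (rule poly_eval_add poly_eval_mult)+

end

section \<open>Divisibility by a variable\<close>

text \<open>
  Reduction modulo a variable, with the quotient ring realised inside the polynomial ring. As
  its values lie in an integral domain, divisibility by a variable becomes a question of vanishing.
\<close>
definition set_zero :: "4 \<Rightarrow> quadpoly \<Rightarrow> quadpoly" where
  "set_zero i = poly_eval Const (\<lambda>j. if j = i then 0 else Var j)"

interpretation set_zero: comm_ring_hom "set_zero i" for i
  unfolding set_zero_def by (rule comm_ring_hom_poly_eval[OF comm_ring_hom_Const])

lemma set_zero_Var [simp]: "set_zero i (Var j) = (if j = i then 0 else Var j)"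
  by (simp add: set_zero_def poly_eval_Var[OF comm_ring_hom_Const])

lemma set_zero_Const [simp]: "set_zero i (Const c) = Const c"
  by (simp add: set_zero_def poly_eval_Const[OF comm_ring_hom_Const])

text \<open>
  The polynomials with this property contain constants and variables and are closed under sums and
  products.
\<close>
lemma Var_dvd_diff_set_zero: "Var i dvd p - set_zero i p"
proof (induction p rule: quadpoly_induct)
  case (add p q)
  have "p + q - set_zero i (p + q) = (p - set_zero i p) + (q - set_zero i q)"
    by (simp add: set_zero.hom_add)
  with add show ?case by (metis dvd_add)
next
  case (mult p q)
  have "p * q - set_zero i (p * q) = (p - set_zero i p) * q + set_zero i p * (q - set_zero i q)"
    by (simp add: set_zero.hom_mult algebra_simps)
  with mult show ?case by simp
qed auto

lemma Var_dvd_iff: "Var i dvd p \<longleftrightarrow> set_zero i p = 0"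
proof
  assume "Var i dvd p"
  then obtain q where "p = Var i * q" by (auto elim: dvdE)
  then show "set_zero i p = 0" by (simp add: set_zero.hom_mult)
next
  assume "set_zero i p = 0"
  then show "Var i dvd p" using Var_dvd_diff_set_zero[of i p] by simp
qed

lemma Var_neq_0 [simp]: "Var i \<noteq> 0"
  by (simp add: Var_def flip: keys_eq_empty)

lemma prime_elem_Var: "prime_elem (Var i)"
  by (rule prime_elemI) (auto simp: Var_dvd_iff set_zero.hom_mult)

lemma Var_dvd_Var_power_mult_iff: "i \<noteq> j \<Longrightarrow> Var i dvd Var j ^ n * p \<longleftrightarrow> Var i dvd p"
  by (simp add: Var_dvd_iff set_zero.hom_mult set_zero.hom_power)

lemma Var_dvd_Var_mult_iff: "i \<noteq> j \<Longrightarrow> Var i dvd Var j * p \<longleftrightarrow> Var i dvd p"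
  using Var_dvd_Var_power_mult_iff[of i j 1] by simp

lemma Var_power_dvd_cancel:
  assumes "Var i ^ n dvd p * q" "\<not> Var i dvd p"
  shows "Var i ^ n dvd q"
  using assms
proof (induction n arbitrary: q)
  case (Suc n)
  from Suc.prems have "Var i dvd p * q" by (auto elim: dvd_mult_left)
  with Suc.prems(2) have "Var i dvd q" using prime_elem_dvd_multD[OF prime_elem_Var] by blast
  then obtain r where r: "q = Var i * r" by (auto elim: dvdE)
  with Suc.prems(1) have "Var i * Var i ^ n dvd Var i * (p * r)" by (simp add: mult_ac)
  then have "Var i ^ n dvd p * r" by simp
  with Suc.IH Suc.prems(2) have "Var i ^ n dvd r" by blast
  with r show ?case by simp
qed simp

text \<open>
  A divisor \<open>p\<close> of a power of one variable is prime to that variable as soon as it divides a power of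
  another; its cofactor then absorbs the whole power.
\<close>
lemma dvd_Var_powers_imp_unit:
  assumes "i \<noteq> j" "p dvd Var i ^ m" "p dvd Var j ^ n"
  shows "p dvd 1"
proof -
  have "\<not> Var i dvd p"
  proof
    assume "Var i dvd p"
    then have "Var i dvd Var j ^ n" using assms(3) by (rule dvd_trans)
    then show False using assms(1) by (simp add: Var_dvd_iff set_zero.hom_power)
  qed
  moreover obtain q where q: "Var i ^ m = p * q" using assms(2) by (auto elim: dvdE)
  ultimately have "Var i ^ m dvd q" using Var_power_dvd_cancel[of i m p q] by simp
  then obtain r where "q = Var i ^ m * r" by (auto elim: dvdE)
  with q have "Var i ^ m * (p * r) = Var i ^ m * 1" by (simp add: mult_ac)
  then have "p * r = 1" by (subst (asm) mult_left_cancel) auto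
  then show ?thesis by (metis dvdI)
qed

text \<open>
  Setting two of the variables to zero leaves \<open>Var k ^ n * q\<close>, in which the power of the third variable
  can be cancelled; so the ideal of the two variables contains \<open>q\<close>.
\<close>
lemma in_ideal_two_variables:
  assumes "distinct [i, j, k]" "Var i dvd Var j * p + Var k ^ n * q"
  obtains u v where "q = Var j * u + Var i * v"
proof -
  have "Var j * set_zero i p + Var k ^ n * set_zero i q = 0"
    using assms by (auto simp: Var_dvd_iff set_zero.hom_add set_zero.hom_mult set_zero.hom_power)
  then have "set_zero j (Var j * set_zero i p + Var k ^ n * set_zero i q) = 0" by simp
  then have "set_zero j (set_zero i q) = 0"
    using assms by (auto simp: set_zero.hom_add set_zero.hom_mult set_zero.hom_power split: if_splits)
  then obtain u where u: "set_zero i q = Var j * u" by (auto simp flip: Var_dvd_iff elim: dvdE)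
  obtain v where v: "q - set_zero i q = Var i * v" using Var_dvd_diff_set_zero by (metis dvdE)
  show thesis using that[of u v] u v by (simp add: algebra_simps)
qed

section \<open>Partial derivatives\<close>

lemma partial_deriv_single:
  "partial_deriv i (Poly_Mapping.single m c)
     = Poly_Mapping.single (m - Poly_Mapping.single i 1) (of_nat (Poly_Mapping.lookup m i) * c)"
  by (cases "c = 0") (simp_all add: partial_deriv_def)

lemma partial_deriv_add: "partial_deriv i (p + q) = partial_deriv i p + partial_deriv i q"
proof -
  let ?t = "\<lambda>p m. Poly_Mapping.single (m - Poly_Mapping.single i 1)
       (of_nat (Poly_Mapping.lookup m i) * Poly_Mapping.lookup p m)"
  let ?K = "Poly_Mapping.keys p \<union> Poly_Mapping.keys q"
  have sup: "partial_deriv i r = (\<Sum>m\<in>?K. ?t r m)" if "Poly_Mapping.keys r \<subseteq> ?K" for r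
    unfolding partial_deriv_def by (rule sum.mono_neutral_left) (use that in \<open>auto simp: in_keys_iff\<close>)
  show ?thesis
    using Poly_Mapping.keys_add[of p q]
    by (simp add: sup lookup_add distrib_left single_add sum.distrib)
qed

lemma partial_deriv_mult:
  "partial_deriv i (p * q) = partial_deriv i p * q + p * partial_deriv i q"
proof (induction p rule: poly_additive_induct)
  case (single m c)
  show ?case
  proof (induction q rule: poly_additive_induct)
    case (single n e)
    let ?s = "Poly_Mapping.single i (1::nat)"
    \<comment> \<open>Lowering the exponent of a product lowers that of either factor, unless it is \<open>0\<close> there.\<close>
    have m: "(m + n) - ?s = (m - ?s) + n" if "Poly_Mapping.lookup m i \<noteq> 0"
      using that by (intro poly_mapping_eqI) (auto simp: lookup_add lookup_minus lookup_single when_def)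
    have n: "(m + n) - ?s = m + (n - ?s)" if "Poly_Mapping.lookup n i \<noteq> 0"
      using that by (intro poly_mapping_eqI) (auto simp: lookup_add lookup_minus lookup_single when_def)
    show ?case
      using m n
      by (cases "Poly_Mapping.lookup m i = 0"; cases "Poly_Mapping.lookup n i = 0")
        (simp_all add: mult_single partial_deriv_single lookup_add algebra_simps flip: single_add)
  qed (simp add: distrib_left partial_deriv_add)
qed (simp add: distrib_right partial_deriv_add)

lemma partial_deriv_Var [simp]: "partial_deriv i (Var j) = (if j = i then 1 else 0)"
  by (simp add: Var_def partial_deriv_single lookup_single)

lemma partial_deriv_power:
  "partial_deriv i (p ^ Suc n) = of_nat (Suc n) * p ^ n * partial_deriv i p"
  by (induction n) (simp_all add: partial_deriv_mult algebra_simps)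

lemma square_dvd_imp_dvd_partial_deriv:
  assumes "p ^ 2 dvd f"
  shows "p dvd partial_deriv i f"
proof -
  obtain q where "f = p * (p * q)" using assms
    by (metis dvdE power2_eq_square mult.assoc)
  then show ?thesis by (simp add: partial_deriv_mult)
qed

section \<open>Homogeneous polynomials\<close>

lemma homogeneous_Const: "homogeneous 0 (Const c)"
  by (simp add: homogeneous_def Const_def monom_degree_def)

lemma homogeneous_Var: "homogeneous 1 (Var i)"
  by (simp add: homogeneous_def Var_def monom_degree_def lookup_single when_def)

lemma homogeneous_0: "homogeneous k 0"
  by (simp add: homogeneous_def)

lemma homogeneous_add: "homogeneous k p \<Longrightarrow> homogeneous k q \<Longrightarrow> homogeneous k (p + q)"
  using Poly_Mapping.keys_add[of p q] by (auto simp: homogeneous_def)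

lemma homogeneous_uminus: "homogeneous k p \<Longrightarrow> homogeneous k (- p)"
  by (simp add: homogeneous_def)

lemma homogeneous_mult: "homogeneous k p \<Longrightarrow> homogeneous l q \<Longrightarrow> homogeneous (k + l) (p * q)"
  using Poly_Mapping.keys_mult[of p q]
  by (fastforce simp: homogeneous_def monom_degree_def lookup_add sum.distrib)

lemma homogeneous_power: "homogeneous k p \<Longrightarrow> homogeneous (int n * k) (p ^ n)"
proof (induction n)
  case 0
  show ?case using homogeneous_Const[of 1] by (simp add: Const_def)
next
  case (Suc n)
  then have "homogeneous (k + int n * k) (p * p ^ n)" by (intro homogeneous_mult)
  then show ?case by (simp add: algebra_simps)
qed

lemma homogeneous_of_nat: "homogeneous 0 (of_nat k)"
  using homogeneous_Const[of "of_nat k"] by (simp add: Const_def)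

lemma homogeneous_Var_power: "homogeneous (int k) (Var i ^ k)"
  using homogeneous_power[OF homogeneous_Var, of k i] by simp

text \<open>
  Degrees are variables constrained by equations, so that repeated resolution determines the degree of
  an expression and leaves one linear equation between integers.
\<close>
lemma homogeneous_intros:
  "homogeneous k 0"
  "k = 0 \<Longrightarrow> homogeneous k (of_nat j)"
  "k = int j \<Longrightarrow> homogeneous k (Var i ^ j)"
  "k = 1 \<Longrightarrow> homogeneous k (Var i)"
  "homogeneous k p \<Longrightarrow> homogeneous k (- p)"
  "homogeneous k p \<Longrightarrow> homogeneous k q \<Longrightarrow> homogeneous k (p + q)"
  "homogeneous k p \<Longrightarrow> homogeneous l q \<Longrightarrow> m = k + l \<Longrightarrow> homogeneous m (p * q)"
  by (auto intro: homogeneous_0 homogeneous_of_nat homogeneous_Var_power homogeneous_Var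
      homogeneous_uminus homogeneous_add homogeneous_mult)

text \<open>
  A monomial of positive degree is a multiple of some variable. Hence a graded resolution is minimal
  whenever all its matrix entries have positive degree.
\<close>
lemma homogeneous_pos_in_irrelevant_ideal:
  assumes "homogeneous k p" "k > 0"
  shows "p \<in> irrelevant_ideal"
proof -
  interpret Modules.module "(*) :: quadpoly \<Rightarrow> quadpoly \<Rightarrow> quadpoly" by (rule module_mult)
  have "Poly_Mapping.single m c \<in> irrelevant_ideal" if "m \<in> Poly_Mapping.keys p" for m c
  proof -
    have "monom_degree m \<noteq> 0" using assms that by (auto simp: homogeneous_def)
    then obtain i where "Poly_Mapping.lookup m i \<noteq> 0" by (auto simp: monom_degree_def)
    then have "Var i dvd (\<Prod>i\<in>UNIV. Var i ^ Poly_Mapping.lookup m i)"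
      by (intro dvd_trans[OF dvd_power dvd_prodI[of _ i]]) auto
    then have "Var i dvd Poly_Mapping.single m c"
      unfolding single_monomial by simp
    then obtain q where "Poly_Mapping.single m c = q * Var i" by (metis dvdE mult.commute)
    then show ?thesis
      by (simp add: irrelevant_ideal_def ideal_generated_def span_scale span_base)
  qed
  moreover have "p = (\<Sum>m\<in>Poly_Mapping.keys p. Poly_Mapping.single m (Poly_Mapping.lookup p m))"
    by (rule poly_mapping_eqI) (auto simp: lookup_sum lookup_single when_def in_keys_iff)
  ultimately show ?thesis
    unfolding irrelevant_ideal_def ideal_generated_def by (metis (lifting) span_sum)
qed

section \<open>The surface and its partial derivatives\<close>

abbreviation X :: quadpoly where "X \<equiv> Var 0"
abbreviation Y :: quadpoly where "Y \<equiv> Var 1"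
abbreviation Z :: quadpoly where "Z \<equiv> Var 2"
abbreviation W :: quadpoly where "W \<equiv> Var 3"

text \<open>
  The degree is \<open>n + 4\<close>; this parametrisation keeps truncated subtraction out of the exponents.
\<close>
definition surface :: "nat \<Rightarrow> quadpoly" where
  "surface n = X ^ (n + 3) * Z + Y ^ (n + 4) + X ^ (n + 2) * Y * W"

definition surface_dx :: "nat \<Rightarrow> quadpoly" where
  "surface_dx n = of_nat (n + 3) * X ^ (n + 2) * Z + of_nat (n + 2) * X ^ (n + 1) * Y * W"

definition surface_dy :: "nat \<Rightarrow> quadpoly" where
  "surface_dy n = of_nat (n + 4) * Y ^ (n + 3) + X ^ (n + 2) * W"

lemma partial_deriv_surface:
  "partial_deriv 0 (surface n) = surface_dx n"
  "partial_deriv 1 (surface n) = surface_dy n"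
  "partial_deriv 2 (surface n) = X ^ (n + 3)"
  "partial_deriv 3 (surface n) = X ^ (n + 2) * Y"
proof -
  have pow: "partial_deriv i (p ^ (n + k)) = of_nat (n + k) * p ^ (n + k - 1) * partial_deriv i p"
    if "k > 0" for i p k
    using partial_deriv_power[of i p "n + k - 1"] that by simp
  show "partial_deriv 0 (surface n) = surface_dx n"
    and "partial_deriv 1 (surface n) = surface_dy n"
    and "partial_deriv 2 (surface n) = X ^ (n + 3)"
    and "partial_deriv 3 (surface n) = X ^ (n + 2) * Y"
    unfolding surface_def surface_dx_def surface_dy_def
    by (simp_all add: partial_deriv_add partial_deriv_mult pow del: power_Suc of_nat_add add_2_eq_Suc')
      (simp_all add: power_add power_numeral_reduce mult_ac)
qed

lemma surface_homogeneous: "homogeneous (int (n + 4)) (surface n)"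
  unfolding surface_def by (rule homogeneous_intros refl | simp)+

lemma surface_dx_homogeneous: "k = int (n + 3) \<Longrightarrow> homogeneous k (surface_dx n)"
  unfolding surface_dx_def by (rule homogeneous_intros refl | simp)+

lemma surface_dy_homogeneous: "k = int (n + 3) \<Longrightarrow> homogeneous k (surface_dy n)"
  unfolding surface_dy_def by (rule homogeneous_intros refl | simp)+

lemma surface_squarefree: "squarefree (surface n)"
proof (rule squarefreeI)
  fix p assume "p ^ 2 dvd surface n"
  then have dvd: "p dvd partial_deriv i (surface n)" for i
    by (rule square_dvd_imp_dvd_partial_deriv)
  have x: "p dvd X ^ (n + 3)" using dvd[of 2] by (simp add: partial_deriv_surface)
  \<comment> \<open>The combination in which the term \<open>x\<^bsup>n+2\<^esup>yw\<close> cancels.\<close>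
  have "p dvd Y * surface_dy n - W * (X ^ (n + 2) * Y)"
    using dvd[of 1] dvd[of 3] by (auto simp: partial_deriv_surface simp del: power_Suc add_2_eq_Suc')
  also have "Y * surface_dy n - W * (X ^ (n + 2) * Y) = of_nat (n + 4) * Y ^ (n + 4)"
    by (simp add: surface_dy_def algebra_simps power_numeral_reduce power_add)
  finally have "p dvd Const (1 / of_nat (n + 4)) * (of_nat (n + 4) * Y ^ (n + 4))"
    by (rule dvd_mult)
  also have "\<dots> = Y ^ (n + 4)"
    using Const_inverse_of_nat[of "n + 4"] by (simp del: of_nat_add flip: mult.assoc)
  finally show "p dvd 1"
    using dvd_Var_powers_imp_unit[OF _ x, of 1] by simp
qed

section \<open>The surface is not a cone\<close>

lemma all_quad: "(\<forall>i::4. P i) \<longleftrightarrow> P 0 \<and> P 1 \<and> P 2 \<and> P 3"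
proof -
  have "(4::4) = 0" by simp
  then show ?thesis by (metis forall_4)
qed

lemma poly_eval_linear_change:
  "poly_eval id v (linear_change A p) = poly_eval id (\<lambda>k. \<Sum>j\<in>UNIV. vec_nth (vec_nth A k) j * v j) p"
proof -
  have id: "comm_ring_hom (id :: complex \<Rightarrow> complex)" by unfold_locales auto
  interpret comm_ring_hom "poly_eval id v" by (rule comm_ring_hom_poly_eval[OF id])
  show ?thesis
    unfolding poly_eval_def[of id _ p]
    by (simp add: linear_change_def hom_distribs poly_eval_Const[OF id] poly_eval_Var[OF id])
qed

lemma poly_eval_not_depends_on:
  assumes "\<not> depends_on p i"
  shows "poly_eval \<iota> (v(i := t)) p = poly_eval \<iota> v p"
  unfolding poly_eval_def
proof (intro sum.cong refl arg_cong[where f = "\<lambda>a. _ * a"] prod.cong)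
  fix m k assume "m \<in> Poly_Mapping.keys p"
  then have "Poly_Mapping.lookup m i = 0" using assms by (auto simp: depends_on_def)
  then show "(v(i := t)) k ^ Poly_Mapping.lookup m k = v k ^ Poly_Mapping.lookup m k" by simp
qed

text \<open>
  In coordinates in which one variable is missing, moving along that coordinate axis does not change the
  value; back in the original coordinates, this is translation along a column of the matrix.
\<close>
lemma cone_imp_translation_invariant:
  assumes "cone f"
  obtains c where "c \<noteq> (\<lambda>_. 0)" "\<And>u t. poly_eval id (\<lambda>k. u k + t * c k) f = poly_eval id u f"
proof -
  obtain A i where A: "invertible A" and i: "\<not> depends_on (linear_change A f) i"
    using assms by (auto simp: cone_def)
  obtain B where AB: "A ** B = Finite_Cartesian_Product.mat 1"
    and BA: "B ** A = Finite_Cartesian_Product.mat 1"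
    using A by (auto simp: invertible_def)
  let ?c = "\<lambda>k. vec_nth (vec_nth A k) i"
  let ?A = "\<lambda>v k. \<Sum>j\<in>UNIV. vec_nth (vec_nth A k) j * v j"
  show thesis
  proof
    show "?c \<noteq> (\<lambda>_. 0)"
    proof
      assume "?c = (\<lambda>_. 0)"
      then have "vec_nth (vec_nth (B ** A) i) i = 0"
        by (simp add: matrix_matrix_mult_def fun_eq_iff)
      then show False by (simp add: BA Finite_Cartesian_Product.mat_def)
    qed
    fix u t
    let ?v = "vec_nth (B *v vec_lambda u)"
    have "A *v (B *v vec_lambda u) = vec_lambda u"
      by (simp add: matrix_vector_mul_assoc AB)
    then have u: "?A ?v = u"
      by (simp add: matrix_vector_mult_def vec_eq_iff fun_eq_iff)
    have "?A (?v(i := ?v i + t)) k = ?A ?v k + t * ?c k" for k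
    proof -
      have "?A (?v(i := ?v i + t)) k = (\<Sum>j\<in>UNIV. vec_nth (vec_nth A k) j * ?v j
          + (if j = i then vec_nth (vec_nth A k) j * t else 0))"
        by (rule sum.cong) (auto simp: algebra_simps)
      then show ?thesis by (simp add: sum.distrib)
    qed
    then have "?A (?v(i := ?v i + t)) = (\<lambda>k. u k + t * ?c k)"
      by (simp add: fun_eq_iff fun_cong[OF u])
    then show "poly_eval id (\<lambda>k. u k + t * ?c k) f = poly_eval id u f"
      using poly_eval_not_depends_on[OF i, of id ?v "?v i + t"] u
      by (simp add: poly_eval_linear_change)
  qed
qed

lemma poly_eval_surface:
  "poly_eval id v (surface n) = v 0 ^ (n + 3) * v 2 + v 1 ^ (n + 4) + v 0 ^ (n + 2) * v 1 * v 3"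
proof -
  have id: "comm_ring_hom (id :: complex \<Rightarrow> complex)" by unfold_locales auto
  interpret comm_ring_hom "poly_eval id v" by (rule comm_ring_hom_poly_eval[OF id])
  show ?thesis
    unfolding surface_def by (simp only: hom_distribs poly_eval_Var[OF id])
qed

text \<open>
  The coordinates of a direction of invariance vanish one after the other. A line through a point with
  \<open>x = 0\<close>, on which \<open>f = y\<^sup>d\<close> does not depend on \<open>z\<close>, would reach \<open>x = 1\<close>, where \<open>f\<close> does depend on \<open>z\<close>;
  so \<open>x\<close> is constant along it. On \<open>x = 0\<close> the values \<open>y\<^sup>d\<close> then force \<open>y\<close> to be constant, and on \<open>x = 1\<close>
  the function is affine in \<open>z\<close> and \<open>w\<close> for fixed \<open>y\<close>, with gradient \<open>(1, y)\<close>.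
\<close>
lemma surface_not_cone: "\<not> cone (surface n)"
proof
  assume "cone (surface n)"
  then obtain c where c: "c \<noteq> (\<lambda>_. 0)"
    and inv: "\<And>u t. poly_eval id (\<lambda>k. u k + t * c k) (surface n) = poly_eval id u (surface n)"
    by (rule cone_imp_translation_invariant) blast
  define F where "F a b e g = a ^ (n + 3) * e + b ^ (n + 4) + a ^ (n + 2) * b * g" for a b e g :: complex
  have F: "F (a + t * c 0) (b + t * c 1) (e + t * c 2) (g + t * c 3) = F a b e g" for a b e g t
    using inv[of "\<lambda>k. if k = 0 then a else if k = 1 then b else if k = 2 then e else g" t]
    by (simp add: poly_eval_surface F_def)
  have c0: "c 0 = 0"
  proof (rule ccontr)
    assume "c 0 \<noteq> 0"
    then show False
      using F[of 0 "1 / c 0" 0 1 0] F[of 0 "1 / c 0" 0 0 0]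
      by (simp add: F_def power_0_left add.assoc)
  qed
  have c1: "c 1 = 0" using F[of 0 1 0 0 0] c0 by (simp add: F_def power_0_left)
  have c2: "c 2 = 0" using F[of 1 1 0 0 0] c0 c1 by (simp add: F_def)
  have c3: "c 3 = 0" using F[of 1 1 1 0 0] c0 c1 c2 by (simp add: F_def)
  show False using c c0 c1 c2 c3 all_quad[of "\<lambda>k. c k = 0"] by auto
qed

section \<open>Vectors and matrices given by lists\<close>

lemma carrier_vec_4: "carrier_vec 4 = (\<Union>a b c e. {vec_of_list [a, b, c, e]})"
proof (intro equalityI subsetI)
  fix v :: "'a vec" assume "v \<in> carrier_vec 4"
  then have "length (list_of_vec v) = 4" by simp
  then obtain a b c e where "list_of_vec v = [a, b, c, e]"
    by (auto simp: numeral_eq_Suc length_Suc_conv simp del: length_list_of_vec)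
  then have "v = vec_of_list [a, b, c, e]" by (metis vec_list)
  then show "v \<in> (\<Union>a b c e. {vec_of_list [a, b, c, e]})" by auto
next
  fix v :: "'a vec" assume "v \<in> (\<Union>a b c e. {vec_of_list [a, b, c, e]})"
  then show "v \<in> carrier_vec 4" by (auto intro!: carrier_vecI)
qed

lemma carrier_vec_1: "carrier_vec 1 = (\<Union>a. {vec_of_list [a]})"
proof (intro equalityI subsetI)
  fix v :: "'a vec" assume "v \<in> carrier_vec 1"
  then have "length (list_of_vec v) = 1" by simp
  then obtain a where "list_of_vec v = [a]"
    by (auto simp: length_Suc_conv simp del: length_list_of_vec)
  then have "v = vec_of_list [a]" by (metis vec_list)
  then show "v \<in> (\<Union>a. {vec_of_list [a]})" by auto
next
  fix v :: "'a vec" assume "v \<in> (\<Union>a. {vec_of_list [a]})"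
  then show "v \<in> carrier_vec 1" by (auto intro!: carrier_vecI)
qed

lemma vec_of_list_carrier: "length xs = k \<Longrightarrow> vec_of_list xs \<in> carrier_vec k"
  by (intro carrier_vecI) simp

lemma mat_imageI: "v \<in> carrier_vec (dim_col A) \<Longrightarrow> A *\<^sub>v v \<in> mat_image A"
  by (simp add: mat_image_def)

lemma mat_mult_vec_4:
  "mat_of_rows_list 4 rs *\<^sub>v vec_of_list [a, b, c, e]
     = vec_of_list (map (\<lambda>r. r ! 0 * a + r ! 1 * b + r ! 2 * c + r ! 3 * e) rs)"
proof (rule eq_vecI)
  fix i assume "i < dim_vec (vec_of_list (map (\<lambda>r. r ! 0 * a + r ! 1 * b + r ! 2 * c + r ! 3 * e) rs))"
  then have i: "i < length rs" by simp
  have "{0..<4} = {0, 1, 2, 3::nat}" by auto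
  with i show "vec_index (mat_of_rows_list 4 rs *\<^sub>v vec_of_list [a, b, c, e]) i
      = vec_index (vec_of_list (map (\<lambda>r. r ! 0 * a + r ! 1 * b + r ! 2 * c + r ! 3 * e) rs)) i"
    by (simp add: mat_of_rows_list_def scalar_prod_def vec_of_list_index numeral_2_eq_2 numeral_3_eq_3)
qed (simp add: mat_of_rows_list_def)

lemma mat_mult_vec_1:
  "mat_of_rows_list 1 rs *\<^sub>v vec_of_list [a] = vec_of_list (map (\<lambda>r. r ! 0 * a) rs)"
  by (rule eq_vecI) (simp_all add: mat_of_rows_list_def scalar_prod_def vec_of_list_index)

lemma zero_vec_eq_vec_of_list: "0\<^sub>v k = vec_of_list (replicate k 0)"
  by (rule eq_vecI) (simp_all add: vec_of_list_index)

lemma vec_of_list_eq_iff: "vec_of_list xs = vec_of_list ys \<longleftrightarrow> xs = ys"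
  by (metis list_vec)

lemma mat_mult_vec_no_columns:
  assumes "A \<in> carrier_mat k 0" "v \<in> carrier_vec 0"
  shows "A *\<^sub>v v = 0\<^sub>v k"
  using assms by (intro eq_vecI) (auto simp: scalar_prod_def)

lemma mat_image_no_columns:
  fixes A :: "quadpoly mat"
  assumes "A \<in> carrier_mat k 0"
  shows "mat_image A = {0\<^sub>v k}"
proof -
  have "dim_col A = 0" using assms by simp
  then have "mat_image A = (\<lambda>v. A *\<^sub>v v) ` carrier_vec 0"
    by (simp only: mat_image_def)
  also have "\<dots> = (\<lambda>v :: quadpoly vec. 0\<^sub>v k) ` carrier_vec 0"
    by (rule image_cong[OF refl]) (rule mat_mult_vec_no_columns[OF assms])
  finally show ?thesis
    by (simp only: image_constant[OF zero_carrier_vec])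
qed

lemma mat_kernel_no_columns: "A \<in> carrier_mat k 0 \<Longrightarrow> mat_kernel A = {0\<^sub>v 0}"
  using mat_mult_vec_no_columns[of A k] by (auto simp: mat_kernel_def)

text \<open>
  With lists in place of indices, the degrees of all entries of a concrete matrix are unfolded by
  rewriting.
\<close>
lemma graded_hom_mat_of_rows_list:
  assumes "list_all2 (\<lambda>e' r. list_all2 (\<lambda>e p. homogeneous (e' - e) p) E r) E' rs"
    and "k = length E"
  shows "graded_hom E E' (mat_of_rows_list k rs)"
  using assms by (auto simp: graded_hom_def mat_of_rows_list_def list_all2_conv_all_nth)

section \<open>Presentation of the Milnor algebra by the gradient\<close>

lemma jacobian_ideal_eq:
  "jacobian_ideal f = (\<Union>a b c e. {partial_deriv 0 f * a + partial_deriv 1 f * b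
      + partial_deriv 2 f * c + partial_deriv 3 f * e})" (is "_ = ?I")
proof -
  interpret Modules.module "(*) :: quadpoly \<Rightarrow> quadpoly \<Rightarrow> quadpoly" by (rule module_mult)
  let ?d = "\<lambda>i. partial_deriv i f"
  have "jacobian_ideal f \<subseteq> ?I"
    unfolding jacobian_ideal_def ideal_generated_def
  proof (rule span_minimal)
    have "\<forall>i. ?d i \<in> ?I"
      unfolding all_quad
    proof (intro conjI)
      have "?d 0 = ?d 0 * 1 + ?d 1 * 0 + ?d 2 * 0 + ?d 3 * 0" by simp then show "?d 0 \<in> ?I" by blast
      have "?d 1 = ?d 0 * 0 + ?d 1 * 1 + ?d 2 * 0 + ?d 3 * 0" by simp then show "?d 1 \<in> ?I" by blast
      have "?d 2 = ?d 0 * 0 + ?d 1 * 0 + ?d 2 * 1 + ?d 3 * 0" by simp then show "?d 2 \<in> ?I" by blast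
      have "?d 3 = ?d 0 * 0 + ?d 1 * 0 + ?d 2 * 0 + ?d 3 * 1" by simp then show "?d 3 \<in> ?I" by blast
    qed
    then show "Set.range ?d \<subseteq> ?I" by blast
    show "subspace ?I"
    proof (rule subspaceI)
      have "0 = ?d 0 * 0 + ?d 1 * 0 + ?d 2 * 0 + ?d 3 * 0" by simp then show "0 \<in> ?I" by blast
    next
      fix p q assume "p \<in> ?I" "q \<in> ?I"
      then obtain a b c e a' b' c' e' where
        "p = ?d 0 * a + ?d 1 * b + ?d 2 * c + ?d 3 * e" "q = ?d 0 * a' + ?d 1 * b' + ?d 2 * c' + ?d 3 * e'"
        by auto
      then have "p + q = ?d 0 * (a + a') + ?d 1 * (b + b') + ?d 2 * (c + c') + ?d 3 * (e + e')"
        by (simp add: algebra_simps)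
      then show "p + q \<in> ?I" by blast
    next
      fix r p assume "p \<in> ?I"
      then obtain a b c e where "p = ?d 0 * a + ?d 1 * b + ?d 2 * c + ?d 3 * e" by auto
      then have "r * p = ?d 0 * (r * a) + ?d 1 * (r * b) + ?d 2 * (r * c) + ?d 3 * (r * e)"
        by (simp only: distrib_left mult.left_commute[of r])
      then show "r * p \<in> ?I" by blast
    qed
  qed
  moreover have "?d i * a \<in> span (Set.range ?d)" for i a
    using span_scale[OF span_base[of "?d i" "Set.range ?d"], of a] by (simp add: mult.commute)
  then have "?I \<subseteq> jacobian_ideal f"
    unfolding jacobian_ideal_def ideal_generated_def by (auto intro!: span_add)
  ultimately show ?thesis by blast
qed

lemma residue_class_eq_iff:
  "residue_class (jacobian_ideal f) p = residue_class (jacobian_ideal f) 0 \<longleftrightarrow> p \<in> jacobian_ideal f"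
proof -
  interpret Modules.module "(*) :: quadpoly \<Rightarrow> quadpoly \<Rightarrow> quadpoly" by (rule module_mult)
  have s: "subspace (jacobian_ideal f)"
    unfolding jacobian_ideal_def ideal_generated_def by (rule subspace_span)
  show ?thesis
  proof
    assume "residue_class (jacobian_ideal f) p = residue_class (jacobian_ideal f) 0"
    moreover have "p \<in> residue_class (jacobian_ideal f) p"
      using subspace_0[OF s] by (simp add: residue_class_def)
    ultimately show "p \<in> jacobian_ideal f" by (simp add: residue_class_def)
  next
    assume p: "p \<in> jacobian_ideal f"
    show "residue_class (jacobian_ideal f) p = residue_class (jacobian_ideal f) 0"
      unfolding residue_class_def
      using subspace_add[OF s _ p] subspace_diff[OF s _ p] by fastforce
  qed
qed

definition gradient_mat :: "quadpoly \<Rightarrow> quadpoly mat" where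
  "gradient_mat f =
     mat_of_rows_list 4 [[partial_deriv 0 f, partial_deriv 1 f, partial_deriv 2 f, partial_deriv 3 f]]"

lemma gradient_mat_dims: "dim_row (gradient_mat f) = 1" "dim_col (gradient_mat f) = 4"
  by (simp_all add: gradient_mat_def mat_of_rows_list_def)

lemma scalar_prod_single: "scalar_prod (vec_of_list [1]) (vec_of_list [p]) = (p :: quadpoly)"
  by (simp add: scalar_prod_def)

lemma augmentation_kernel:
  "{v \<in> carrier_vec 1. augmentation (jacobian_ideal f) (vec_of_list [1]) v
       = residue_class (jacobian_ideal f) 0} = mat_image (gradient_mat f)"
proof -
  have "{v \<in> carrier_vec 1. augmentation (jacobian_ideal f) (vec_of_list [1]) v
       = residue_class (jacobian_ideal f) 0} = (\<lambda>p. vec_of_list [p]) ` jacobian_ideal f"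
    by (auto simp: augmentation_def scalar_prod_single residue_class_eq_iff carrier_vec_1
        simp del: vec_of_list_Cons One_nat_def)
  also have "\<dots> = mat_image (gradient_mat f)"
    unfolding mat_image_def gradient_mat_dims unfolding gradient_mat_def
    by (auto simp: jacobian_ideal_eq carrier_vec_4 mat_mult_vec_4 image_UN simp del: vec_of_list_Cons)
  finally show ?thesis .
qed

section \<open>The syzygies of the gradient\<close>

text \<open>
  The columns are the four syzygies, the rows belong to \<open>f\<^sub>x, f\<^sub>y, f\<^sub>z, f\<^sub>w\<close>. The first column is
  the relation between the monomials \<open>f\<^sub>z\<close> and \<open>f\<^sub>w\<close>, the second expresses \<open>x f\<^sub>x\<close> by them. The last two
  express \<open>x\<^bsup>n+2\<^esup>f\<^sub>y\<close> and \<open>(d-2) x\<^bsup>n+1\<^esup>w f\<^sub>y\<close> by the other derivatives. The entry with \<open>x\<^sup>n\<close> is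
  where \<open>d \<ge> 4\<close> enters.
\<close>
definition syzygy_mat :: "nat \<Rightarrow> quadpoly mat" where
  "syzygy_mat n = mat_of_rows_list 4
    [[0, X, 0, - (of_nat (n + 4) * Y ^ (n + 2))],
     [0, 0, X ^ (n + 2), of_nat (n + 2) * X ^ (n + 1) * W],
     [Y, - (of_nat (n + 3) * Z), - (X ^ (n + 1) * W), - (of_nat (n + 2) * X ^ n * W ^ 2)],
     [- X, - (of_nat (n + 2) * W), - (of_nat (n + 4) * Y ^ (n + 2)),
      of_nat (n + 4) * of_nat (n + 3) * Y ^ (n + 1) * Z]]"

text \<open>
  With the factors \<open>-(d-2) w\<close> and \<open>x\<close> the coefficients of \<open>f\<^sub>y\<close> in the two syzygies of degree \<open>n + 2\<close>
  cancel, and the rest is a combination of the two linear syzygies.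
\<close>
definition second_syzygy_mat :: "nat \<Rightarrow> quadpoly mat" where
  "second_syzygy_mat n = mat_of_rows_list 1
    [[of_nat (n + 4) * of_nat (n + 3) * Y ^ (n + 1) * Z], [of_nat (n + 4) * Y ^ (n + 2)],
     [- (of_nat (n + 2) * W)], [X]]"

lemma syzygy_mat_dims:
  "dim_row (syzygy_mat n) = 4" "dim_col (syzygy_mat n) = 4"
  "dim_row (second_syzygy_mat n) = 4" "dim_col (second_syzygy_mat n) = 1"
  by (simp_all add: syzygy_mat_def second_syzygy_mat_def mat_of_rows_list_def)

text \<open>
  The coefficient \<open>b\<close> of \<open>f\<^sub>y\<close> decides: it is shown to lie in the ideal \<open>(x\<^bsup>n+2\<^esup>, x\<^bsup>n+1\<^esup>w)\<close>, whose generators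
  come from the last two syzygies. Once their contribution is removed, \<open>a\<close> is a multiple of
  \<open>x\<close>, which the second syzygy removes, and a relation between \<open>x\<^bsup>n+3\<^esup>\<close> and \<open>x\<^bsup>n+2\<^esup>y\<close> remains.
\<close>
lemma syzygies_of_gradient:
  assumes "surface_dx n * a + surface_dy n * b + X ^ (n + 3) * c + X ^ (n + 2) * Y * e = 0"
  obtains s1 s2 s3 s4 where
    "a = X * s2 - of_nat (n + 4) * Y ^ (n + 2) * s4"
    "b = X ^ (n + 2) * s3 + of_nat (n + 2) * X ^ (n + 1) * W * s4"
    "c = Y * s1 - of_nat (n + 3) * Z * s2 - X ^ (n + 1) * W * s3 - of_nat (n + 2) * X ^ n * W ^ 2 * s4"
    "e = - X * s1 - of_nat (n + 2) * W * s2 - of_nat (n + 4) * Y ^ (n + 2) * s3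
       + of_nat (n + 4) * of_nat (n + 3) * Y ^ (n + 1) * Z * s4"
proof -
  define D D1 D2 :: quadpoly where D: "D = of_nat (n + 4)" "D1 = of_nat (n + 3)" "D2 = of_nat (n + 2)"
  \<comment> \<open>The inverses of the constants \<open>d\<close> and \<open>d - 2\<close>.\<close>
  define u4 u2 where "u4 = Const (1 / of_nat (n + 4))" "u2 = Const (1 / of_nat (n + 2))"
  then have u: "u4 * D = 1" "u2 * D2 = 1"
    using Const_inverse_of_nat[of "n + 4"] Const_inverse_of_nat[of "n + 2"]
    by (simp_all add: D del: of_nat_add)
  \<comment> \<open>Modulo \<open>x\<^bsup>n+1\<^esup>\<close> only the term \<open>d y\<^bsup>n+3\<^esup>b\<close> of the relation survives.\<close>
  have "Y ^ (n + 3) * b = u4 * D * Y ^ (n + 3) * b" by (simp add: u)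
  also have "\<dots> = u4 * (surface_dx n * a + surface_dy n * b + X ^ (n + 3) * c + X ^ (n + 2) * Y * e)
      - X ^ (n + 1) * u4 * ((D1 * X * Z + D2 * Y * W) * a + X * W * b + X ^ 2 * c + X * Y * e)"
    unfolding surface_dx_def surface_dy_def D[symmetric]
    by (simp add: algebra_simps power_numeral_reduce power_add)
  also have "\<dots> = X ^ (n + 1) * (- u4 * ((D1 * X * Z + D2 * Y * W) * a + X * W * b + X ^ 2 * c + X * Y * e))"
    unfolding assms by (simp add: mult_ac)
  finally have "X ^ (n + 1) dvd Y ^ (n + 3) * b" by (metis dvdI)
  then have "X ^ (n + 1) dvd b"
    by (rule Var_power_dvd_cancel) (simp add: Var_dvd_iff set_zero.hom_power)
  then obtain b' where b': "b = X ^ (n + 1) * b'" by (auto elim: dvdE)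
  have "X ^ (n + 1) * ((D1 * X * Z + D2 * Y * W) * a + (D * Y ^ (n + 3) + X ^ (n + 2) * W) * b'
      + X ^ 2 * c + X * Y * e) = 0"
    unfolding assms[symmetric] surface_dx_def surface_dy_def b' D[symmetric]
    by (simp add: algebra_simps power_numeral_reduce power_add)
  then have eq: "(D1 * X * Z + D2 * Y * W) * a + (D * Y ^ (n + 3) + X ^ (n + 2) * W) * b'
      + X ^ 2 * c + X * Y * e = 0" by simp
  \<comment> \<open>The relation divided by \<open>x\<^bsup>n+1\<^esup>\<close>, reduced modulo \<open>x\<close>, has the factor \<open>y\<close>.\<close>
  have "Y * (W * (D2 * a) + Y ^ (n + 2) * (D * b'))
      = ((D1 * X * Z + D2 * Y * W) * a + (D * Y ^ (n + 3) + X ^ (n + 2) * W) * b' + X ^ 2 * c + X * Y * e)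
        - X * (D1 * Z * a + X ^ (n + 1) * W * b' + X * c + Y * e)"
    by (simp add: algebra_simps power_numeral_reduce power_add)
  also have "\<dots> = X * (- (D1 * Z * a + X ^ (n + 1) * W * b' + X * c + Y * e))"
    unfolding eq by (simp only: diff_0 mult_minus_right)
  finally have "X dvd Y * (W * (D2 * a) + Y ^ (n + 2) * (D * b'))" by (metis dvdI)
  then have dvd: "X dvd W * (D2 * a) + Y ^ (n + 2) * (D * b')"
    by (simp add: Var_dvd_Var_mult_iff)
  then obtain p q where pq: "D * b' = W * p + X * q"
    by (rule in_ideal_two_variables[rotated]) auto
  \<comment> \<open>Scaled so that \<open>b' = (d-2) w s\<^sub>4 + x s\<^sub>3\<close>, as the last two columns of the syzygy matrix require.\<close>
  define s4 s3 where s: "s4 = u2 * u4 * p" "s3 = u4 * q"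
  have "b' = u4 * (D * b')" by (simp add: u flip: mult.assoc)
  also have "\<dots> = (u2 * D2) * W * u4 * p + X * s3"
    unfolding pq u s(2) by (simp add: algebra_simps)
  also have "(u2 * D2) * W * u4 * p = D2 * W * s4" unfolding s(1) by (simp only: mult_ac)
  finally have b'2: "b' = D2 * W * s4 + X * s3" .
  have "D2 * W * (a + D * Y ^ (n + 2) * s4)
      = (W * (D2 * a) + Y ^ (n + 2) * (D * b')) - X * (Y ^ (n + 2) * D * s3)"
    unfolding b'2 by (simp add: algebra_simps)
  then have "X dvd D2 * W * (a + D * Y ^ (n + 2) * s4)" using dvd by (auto intro: dvd_diff)
  then have "X dvd u2 * (D2 * W * (a + D * Y ^ (n + 2) * s4))" by simp
  also have "u2 * (D2 * W * (a + D * Y ^ (n + 2) * s4)) = W * (a + D * Y ^ (n + 2) * s4)"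
    using u by (simp flip: mult.assoc)
  finally have "X dvd a + D * Y ^ (n + 2) * s4"
    by (simp add: Var_dvd_Var_mult_iff)
  then obtain s2 where "a + D * Y ^ (n + 2) * s4 = X * s2" by (auto elim: dvdE)
  then have a: "a = X * s2 - D * Y ^ (n + 2) * s4" by (simp add: algebra_simps)
  \<comment> \<open>The last two coefficients after subtracting the multiples of the syzygies found so far.\<close>
  define c' where "c' = c + D1 * Z * s2 + X ^ (n + 1) * W * s3 + D2 * X ^ n * W ^ 2 * s4"
  define e' where "e' = e + D2 * W * s2 + D * Y ^ (n + 2) * s3 - D * D1 * Y ^ (n + 1) * Z * s4"
  have "X * (X * c' + Y * e') = (D1 * X * Z + D2 * Y * W) * a
      + (D * Y ^ (n + 3) + X ^ (n + 2) * W) * b' + X ^ 2 * c + X * Y * e"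
    unfolding a b'2 c'_def e'_def by (simp add: algebra_simps power_numeral_reduce power_add)
  also note eq
  finally have ce: "X * c' + Y * e' = 0" by simp
  then have "X dvd X * c' + Y * e'" by simp
  then have "X dvd Y * e'" by (simp add: dvd_add_right_iff)
  then have "X dvd e'"
    by (simp add: Var_dvd_Var_mult_iff)
  then obtain t where t: "e' = X * t" by (auto elim: dvdE)
  from ce have "X * (c' + Y * t) = 0" unfolding t by (simp add: algebra_simps)
  then have c't: "c' = Y * (- t)" by (simp add: eq_neg_iff_add_eq_0)
  show thesis
  proof (rule that[of s2 s4 s3 "- t"])
    show "a = X * s2 - of_nat (n + 4) * Y ^ (n + 2) * s4" using a by (simp only: D)
    show "b = X ^ (n + 2) * s3 + of_nat (n + 2) * X ^ (n + 1) * W * s4"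
      unfolding b' b'2 D by (simp add: algebra_simps)
    show "c = Y * (- t) - of_nat (n + 3) * Z * s2 - X ^ (n + 1) * W * s3 - of_nat (n + 2) * X ^ n * W ^ 2 * s4"
      unfolding c't[symmetric] unfolding c'_def D by simp
    show "e = - X * (- t) - of_nat (n + 2) * W * s2 - of_nat (n + 4) * Y ^ (n + 2) * s3
       + of_nat (n + 4) * of_nat (n + 3) * Y ^ (n + 1) * Z * s4"
      using t unfolding e'_def D by (simp add: algebra_simps)
  qed
qed

text \<open>
  The integers \<open>d\<close>, \<open>d - 1\<close> and \<open>d - 2\<close> may be replaced by independent indeterminates here, which
  reduces the claim to an identity of commutative rings.
\<close>
lemma gradient_mat_times_syzygies:
  "surface_dx n * (X * s2 - of_nat (n + 4) * Y ^ (n + 2) * s4)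
   + surface_dy n * (X ^ (n + 2) * s3 + of_nat (n + 2) * X ^ (n + 1) * W * s4)
   + X ^ (n + 3) * (Y * s1 - of_nat (n + 3) * Z * s2 - X ^ (n + 1) * W * s3 - of_nat (n + 2) * X ^ n * W ^ 2 * s4)
   + X ^ (n + 2) * Y * (- X * s1 - of_nat (n + 2) * W * s2 - of_nat (n + 4) * Y ^ (n + 2) * s3
       + of_nat (n + 4) * of_nat (n + 3) * Y ^ (n + 1) * Z * s4) = 0"
proof -
  define D D1 D2 :: quadpoly where D: "D = of_nat (n + 4)" "D1 = of_nat (n + 3)" "D2 = of_nat (n + 2)"
  show ?thesis
    unfolding surface_dx_def surface_dy_def D[symmetric]
    by (simp add: algebra_simps power_numeral_reduce power_add)
qed

lemmas mat_dims = gradient_mat_dims syzygy_mat_dims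

lemma mat_kernel_gradient: "mat_kernel (gradient_mat (surface n)) = mat_image (syzygy_mat n)"
proof (intro equalityI subsetI)
  fix v assume "v \<in> mat_kernel (gradient_mat (surface n))"
  then have "v \<in> carrier_vec 4" and 0: "gradient_mat (surface n) *\<^sub>v v = 0\<^sub>v 1"
    by (simp_all add: mat_kernel_def mat_dims)
  then obtain a b c e where v: "v = vec_of_list [a, b, c, e]" unfolding carrier_vec_4 by auto
  from 0 have "surface_dx n * a + surface_dy n * b + X ^ (n + 3) * c + X ^ (n + 2) * Y * e = 0"
    unfolding v gradient_mat_def partial_deriv_surface mat_mult_vec_4 zero_vec_eq_vec_of_list vec_of_list_eq_iff
    by simp
  then obtain s1 s2 s3 s4 where
    "a = X * s2 - of_nat (n + 4) * Y ^ (n + 2) * s4"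
    "b = X ^ (n + 2) * s3 + of_nat (n + 2) * X ^ (n + 1) * W * s4"
    "c = Y * s1 - of_nat (n + 3) * Z * s2 - X ^ (n + 1) * W * s3 - of_nat (n + 2) * X ^ n * W ^ 2 * s4"
    "e = - X * s1 - of_nat (n + 2) * W * s2 - of_nat (n + 4) * Y ^ (n + 2) * s3
       + of_nat (n + 4) * of_nat (n + 3) * Y ^ (n + 1) * Z * s4"
    by (rule syzygies_of_gradient)
  then have v': "v = syzygy_mat n *\<^sub>v vec_of_list [s1, s2, s3, s4]"
    unfolding v syzygy_mat_def mat_mult_vec_4 vec_of_list_eq_iff by simp
  show "v \<in> mat_image (syzygy_mat n)"
    unfolding v' by (intro mat_imageI vec_of_list_carrier) (simp add: mat_dims)
next
  fix v assume "v \<in> mat_image (syzygy_mat n)"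
  then obtain s where v: "v = syzygy_mat n *\<^sub>v s" and "s \<in> carrier_vec 4"
    by (auto simp: mat_image_def mat_dims)
  then obtain s1 s2 s3 s4 where s: "s = vec_of_list [s1, s2, s3, s4]" unfolding carrier_vec_4 by auto
  have "gradient_mat (surface n) *\<^sub>v v = 0\<^sub>v 1"
    using gradient_mat_times_syzygies[of n s2 s4 s3 s1]
    unfolding v s syzygy_mat_def gradient_mat_def partial_deriv_surface mat_mult_vec_4 list.map
      zero_vec_eq_vec_of_list vec_of_list_eq_iff
    by simp
  moreover have "v \<in> carrier_vec 4" unfolding v by (rule carrier_vecI) (simp only: dim_mult_mat_vec mat_dims)
  ultimately show "v \<in> mat_kernel (gradient_mat (surface n))"
    by (simp add: mat_kernel_def mat_dims)
qed

text \<open>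
  The row of \<open>f\<^sub>x\<close> says that \<open>x\<close> divides \<open>y\<^bsup>n+2\<^esup>a\<^sub>4\<close>, hence \<open>a\<^sub>4 = x s\<close>; the rows of \<open>f\<^sub>x\<close>, \<open>f\<^sub>y\<close> and \<open>f\<^sub>z\<close>
  then determine \<open>a\<^sub>2\<close>, \<open>a\<^sub>3\<close> and \<open>a\<^sub>1\<close>.
\<close>
lemma mat_kernel_syzygy: "mat_kernel (syzygy_mat n) = mat_image (second_syzygy_mat n)"
proof (intro equalityI subsetI)
  fix v assume "v \<in> mat_kernel (syzygy_mat n)"
  then have "v \<in> carrier_vec 4" and 0: "syzygy_mat n *\<^sub>v v = 0\<^sub>v 4"
    by (simp_all add: mat_kernel_def mat_dims)
  then obtain a1 a2 a3 a4 where v: "v = vec_of_list [a1, a2, a3, a4]" unfolding carrier_vec_4 by auto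
  have "replicate 4 (0::quadpoly) = [0, 0, 0, 0]" by (simp add: numeral_eq_Suc)
  with 0 have
    row_x: "X * a2 + - (of_nat (n + 4) * Y ^ (n + 2)) * a4 = 0" and
    row_y: "X ^ (n + 2) * a3 + of_nat (n + 2) * X ^ (n + 1) * W * a4 = 0" and
    row_z: "Y * a1 + - (of_nat (n + 3) * Z) * a2 + - (X ^ (n + 1) * W) * a3
      + - (of_nat (n + 2) * X ^ n * W ^ 2) * a4 = 0"
    unfolding v syzygy_mat_def mat_mult_vec_4 zero_vec_eq_vec_of_list vec_of_list_eq_iff
    by (simp_all del: of_nat_add of_nat_Suc power_Suc add_2_eq_Suc')
  define D D1 D2 :: quadpoly where D: "D = of_nat (n + 4)" "D1 = of_nat (n + 3)" "D2 = of_nat (n + 2)"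
  have "X * a2 = D * (Y ^ (n + 2) * a4)" using row_x by (simp add: D algebra_simps del: of_nat_add power_Suc)
  then have "X dvd Const (1 / of_nat (n + 4)) * (D * (Y ^ (n + 2) * a4))"
    by (metis dvd_mult dvd_triv_left)
  also have "\<dots> = Y ^ (n + 2) * a4"
    using Const_inverse_of_nat[of "n + 4"] by (simp add: D del: of_nat_add flip: mult.assoc)
  finally have "X dvd a4" by (simp only: Var_dvd_Var_power_mult_iff zero_neq_one not_False_eq_True)
  then obtain s where a4: "a4 = X * s" by (auto elim: dvdE)
  have "X * (a2 - D * Y ^ (n + 2) * s) = 0"
    using row_x unfolding a4 D[symmetric] by (simp add: algebra_simps)
  then have a2: "a2 = D * Y ^ (n + 2) * s" by simp
  have "X ^ (n + 2) * (a3 + D2 * W * s) = 0"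
    using row_y unfolding a4 D[symmetric] by (simp add: algebra_simps)
  then have a3: "a3 = - (D2 * W) * s" by (simp add: eq_neg_iff_add_eq_0)
  have "Y * (a1 - D * D1 * Y ^ (n + 1) * Z * s) = 0"
    unfolding row_z[symmetric] a2 a3 a4 D[symmetric]
    by (simp add: algebra_simps power_numeral_reduce power_add)
  then have a1: "a1 = D * D1 * Y ^ (n + 1) * Z * s" by simp
  have v': "v = second_syzygy_mat n *\<^sub>v vec_of_list [s]"
    unfolding v second_syzygy_mat_def mat_mult_vec_1 vec_of_list_eq_iff a1 a2 a3 a4 D by simp
  show "v \<in> mat_image (second_syzygy_mat n)"
    unfolding v' by (intro mat_imageI vec_of_list_carrier) (simp add: mat_dims)
next
  fix v assume "v \<in> mat_image (second_syzygy_mat n)"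
  then obtain t where v: "v = second_syzygy_mat n *\<^sub>v t" and "t \<in> carrier_vec 1"
    by (auto simp: mat_image_def mat_dims)
  then obtain s where t: "t = vec_of_list [s]" unfolding carrier_vec_1 by auto
  define D D1 D2 :: quadpoly where D: "D = of_nat (n + 4)" "D1 = of_nat (n + 3)" "D2 = of_nat (n + 2)"
  have "replicate 4 (0::quadpoly) = [0, 0, 0, 0]" by (simp add: numeral_eq_Suc)
  then have "syzygy_mat n *\<^sub>v v = 0\<^sub>v 4"
    unfolding v t syzygy_mat_def second_syzygy_mat_def mat_mult_vec_1 list.map mat_mult_vec_4
      zero_vec_eq_vec_of_list vec_of_list_eq_iff D[symmetric]
    by (simp add: algebra_simps power_numeral_reduce power_add)
  moreover have "v \<in> carrier_vec 4" unfolding v by (rule carrier_vecI) (simp only: dim_mult_mat_vec mat_dims)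
  ultimately show "v \<in> mat_kernel (syzygy_mat n)"
    by (simp add: mat_kernel_def mat_dims)
qed

lemma mat_kernel_second_syzygy: "mat_kernel (second_syzygy_mat n) = {0\<^sub>v 1}"
proof (intro equalityI subsetI)
  fix v assume "v \<in> mat_kernel (second_syzygy_mat n)"
  then have "v \<in> carrier_vec 1" and 0: "second_syzygy_mat n *\<^sub>v v = 0\<^sub>v 4"
    by (simp_all add: mat_kernel_def mat_dims)
  then obtain s where v: "v = vec_of_list [s]" unfolding carrier_vec_1 by auto
  have "replicate 4 (0::quadpoly) = [0, 0, 0, 0]" by (simp add: numeral_eq_Suc)
  with 0 have "s = 0"
    unfolding v second_syzygy_mat_def mat_mult_vec_1 zero_vec_eq_vec_of_list vec_of_list_eq_iff by simp
  then show "v \<in> {0\<^sub>v 1}" unfolding v zero_vec_eq_vec_of_list by simp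
next
  fix v :: "quadpoly vec" assume v: "v \<in> {0\<^sub>v 1}"
  have "second_syzygy_mat n *\<^sub>v vec_of_list [0] = 0\<^sub>v 4"
    unfolding second_syzygy_mat_def mat_mult_vec_1 zero_vec_eq_vec_of_list vec_of_list_eq_iff
    by (simp add: numeral_eq_Suc)
  moreover have "v = vec_of_list [0]" using v by (simp add: zero_vec_eq_vec_of_list)
  ultimately show "v \<in> mat_kernel (second_syzygy_mat n)"
    by (simp add: mat_kernel_def mat_dims vec_of_list_carrier del: vec_of_list_Cons One_nat_def)
qed

section \<open>The minimal resolution\<close>

text \<open>
  Beyond the last module the maps are zero matrices without columns, so that exactness at that module
  means injectivity of the last map.
\<close>
lemma surface_resolution:
  "minimal_resolution_has_form (jacobian_ideal (surface n))
     [[0], replicate 4 (- int (n + 3)),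
      [- 1 - int (n + 3), - 1 - int (n + 3), - int (n + 2) - int (n + 3), - int (n + 2) - int (n + 3)],
      [- int (n + 2) - int (n + 4)]]"
  (is "minimal_resolution_has_form ?J ?Fs")
proof -
  define F where "F = (\<lambda>k. if k < length ?Fs then ?Fs ! k else [])"
  define \<phi> where "\<phi> k = (if k = 0 then gradient_mat (surface n) else if k = 1 then syzygy_mat n
    else if k = 2 then second_syzygy_mat n else 0\<^sub>m (length (F k)) (length (F (Suc k))))" for k :: nat
  have F: "F 0 = [0]" "F (Suc 0) = [- int (n + 3), - int (n + 3), - int (n + 3), - int (n + 3)]"
    "F 2 = [- 1 - int (n + 3), - 1 - int (n + 3), - int (n + 2) - int (n + 3), - int (n + 2) - int (n + 3)]"
    "F 3 = [- int (n + 2) - int (n + 4)]"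
    by (simp_all add: F_def numeral_eq_Suc)
  have F_ge: "F k = []" if "k \<ge> 4" for k
    using that by (simp add: F_def)
  have \<phi>: "\<phi> 0 = gradient_mat (surface n)" "\<phi> (Suc 0) = syzygy_mat n" "\<phi> 2 = second_syzygy_mat n"
    by (simp_all add: \<phi>_def)
  have \<phi>_ge: "\<phi> k = 0\<^sub>m (length (F k)) (length (F (Suc k)))" if "k \<ge> 3" for k
    using that by (simp_all add: \<phi>_def)
  have cases: "k = 0 \<or> k = Suc 0 \<or> k = 2 \<or> k \<ge> 3" for k :: nat by linarith
  have hom: "graded_hom (F (Suc k)) (F k) (\<phi> k)" for k
    using cases[of k]
  proof (elim disjE)
    assume k: "k = 0"
    show ?thesis
      unfolding k F \<phi> gradient_mat_def partial_deriv_surface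
      by (rule graded_hom_mat_of_rows_list, simp only: list_all2_Cons list_all2_Nil simp_thms)
        (rule conjI homogeneous_intros surface_dx_homogeneous surface_dy_homogeneous refl | simp)+
  next
    assume k: "k = Suc 0"
    then have k': "Suc k = 2" by simp
    show ?thesis
      unfolding k' unfolding k F \<phi> syzygy_mat_def
      by (rule graded_hom_mat_of_rows_list, simp only: list_all2_Cons list_all2_Nil simp_thms)
        (rule conjI homogeneous_intros refl | simp)+
  next
    assume k: "k = 2"
    then have k': "Suc k = 3" by simp
    show ?thesis
      unfolding k' unfolding k F \<phi> second_syzygy_mat_def
      by (rule graded_hom_mat_of_rows_list, simp only: list_all2_Cons list_all2_Nil simp_thms)
        (rule conjI homogeneous_intros refl | simp)+
  next
    assume k: "k \<ge> 3"
    then show ?thesis by (simp add: graded_hom_def \<phi>_ge F_ge)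
  qed
  have pos: "F k ! i - F (Suc k) ! j > 0" if "i < length (F k)" "j < length (F (Suc k))" for k i j
    using cases[of k] that
    by (elim disjE) (auto simp: F F[unfolded numeral_2_eq_2 numeral_3_eq_3] F_ge less_Suc_eq numeral_eq_Suc)
  have minimal: "\<phi> k $$ (i, j) \<in> irrelevant_ideal" if "i < length (F k)" "j < length (F (Suc k))" for k i j
    using homogeneous_pos_in_irrelevant_ideal[OF _ pos[OF that]] hom[of k] that
    by (simp add: graded_hom_def)
  have exact: "mat_kernel (\<phi> k) = mat_image (\<phi> (Suc k))" for k
    using cases[of k]
  proof (elim disjE)
    assume k: "k = 2"
    have "\<phi> 3 = 0\<^sub>m 1 0" using F F_ge by (simp add: \<phi>_ge)
    then have "mat_image (\<phi> 3) = {0\<^sub>v 1}" by (simp add: mat_image_no_columns)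
    then show ?thesis using mat_kernel_second_syzygy by (simp add: k \<phi> flip: numeral_3_eq_3)
  next
    assume k: "k \<ge> 3"
    then show ?thesis
      by (simp add: \<phi>_ge F_ge mat_kernel_no_columns[of _ "length (F k)"] mat_image_no_columns[of _ 0])
  qed (simp_all add: \<phi> mat_kernel_gradient mat_kernel_syzygy flip: numeral_2_eq_2)
  have "graded_free_resolution ?J F \<phi> (vec_of_list [1])"
    unfolding graded_free_resolution_def
  proof (intro conjI allI impI hom exact)
    show "vec_of_list [1] \<in> carrier_vec (length (F 0))"
      by (rule vec_of_list_carrier) (simp add: F)
    fix j assume "j < length (F 0)"
    then show "homogeneous (- (F 0 ! j)) (vec_index (vec_of_list [1]) j)"
      using homogeneous_of_nat[of 1] by (simp add: F)
  next
    show "augmentation ?J (vec_of_list [1]) ` carrier_vec (length (F 0)) = Set.range (residue_class ?J)"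
    proof (intro equalityI subsetI)
      fix M assume "M \<in> Set.range (residue_class ?J)"
      then obtain p where "M = residue_class ?J p" by blast
      then have "M = augmentation ?J (vec_of_list [1]) (vec_of_list [p])"
        by (simp only: augmentation_def scalar_prod_single)
      moreover have "vec_of_list [p] \<in> carrier_vec (length (F 0))"
        by (rule vec_of_list_carrier) (simp add: F)
      ultimately show "M \<in> augmentation ?J (vec_of_list [1]) ` carrier_vec (length (F 0))"
        by (rule image_eqI)
    qed (auto simp: augmentation_def)
    show "{v \<in> carrier_vec (length (F 0)). augmentation ?J (vec_of_list [1]) v = residue_class ?J 0}
        = mat_image (\<phi> 0)"
      using augmentation_kernel[of "surface n"] by (simp add: F \<phi> del: vec_of_list_Cons)
  qed
  with minimal have "minimal_graded_free_resolution ?J F \<phi> (vec_of_list [1])"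
    by (simp add: minimal_graded_free_resolution_def)
  then show ?thesis
    unfolding minimal_resolution_has_form_def F_def by blast
qed

theorem proposition5p9:
  fixes d :: nat and x y z w :: quadpoly
  defines "x \<equiv> Var 0" and "y \<equiv> Var 1" and "z \<equiv> Var 2" and "w \<equiv> Var 3"
  assumes "d \<ge> 4"
  shows "nearly_free d (x ^ (d - 1) * z + y ^ d + x ^ (d - 2) * y * w) (1, 1, d - 2)"
proof -
  define n where "n = d - 4"
  then have d: "d = n + 4" using assms by simp
  have f: "x ^ (d - 1) * z + y ^ d + x ^ (d - 2) * y * w = surface n"
    by (simp add: surface_def x_def y_def z_def w_def d numeral_eq_Suc)
  have nonzero: "surface n \<noteq> 0"
  proof
    assume "surface n = 0"
    then have "poly_eval id (\<lambda>i. if i = 1 then 1 else 0) (surface n) = 0"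
      by (simp add: poly_eval_def)
    then show False by (simp add: poly_eval_surface power_0_left)
  qed
  have degrees: "- (int (n + 4) - 1) = - int (n + 3)" "n + 4 - 2 = n + 2"
    "- int 1 - (int (n + 4) - 1) = - 1 - int (n + 3)"
    "- int k - (int (n + 4) - 1) = - int k - int (n + 3)" for k by auto
  show ?thesis
    unfolding f unfolding d nearly_free_def prod.case degrees
    using nonzero surface_homogeneous surface_squarefree surface_not_cone surface_resolution
    by (simp del: of_nat_add)
qed

end
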